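(* Assume that either $n<d$, or that the distribution $P_X$ is degenerate. Then the minimax excess risk with respect to the class $\mathcal P_{\mathrm{Gauss}}(P_X,\sigma^2)$ is infinite: $$\inf_{\widehat\beta_n}\ \sup_{P\in\mathcal P_{\mathrm{Gauss}}(P_X,\sigma^2)}\mathbb E\big[\mathcal E_P(\widehat\beta_n)\big]=+\infty .$$
   Context: Let $n,d\ge 1$ be integers, $\sigma^2>0$, and let $P_X$ be a probability distribution on $\mathbb R^d$ such that, for $X\sim P_X$, $\mathbb E\|X\|^2<\infty$ and $\Sigma:=\mathbb E[XX^\top]$ is invertible. $P_X$ is called degenerate if there is a linear hyperplane $H\subset\mathbb R^d$ with $\mathbb P(X\in H)>0$, i.e. there is $\theta\in\mathbb R^d$, $\|\theta\|=1$, with $\mathbb P(\langle\theta,X\rangle=0)>0$. The class $\mathcal P_{\mathrm{Gauss}}(P_X,\sigma^2)$ consists of all joint distributions $P$ of $(X,Y)$ with $X\sim P_X$ and $Y=\langle\beta^*,X\rangle+\varepsilon$, where $\beta^*\in\mathbb R^d$ is arbitrary and $\varepsilon\,|\,X\sim\mathcal N(0,\sigma^2)$. The risk of $\beta\in\mathbb R^d$ under $P$ is $R(\beta)=\mathbb E[(Y-\langle\beta,X\rangle)^2]$; it is uniquely minimized at $\beta^*$, and the excess risk is $\mathcal E_P(\beta)=R(\beta)-R(\beta^* )=\|\Sigma^{1/2}(\beta-\beta^* )\|^2$. An estimator $\widehat\beta_n$ is an $\mathbb R^d$-valued measurable function of an i.i.d. sample $(X_1,Y_1),\dots,(X_n,Y_n)$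 from $P$; the infimum is over all estimators and the expectation is over the sample. *)

theory Defs
  imports "HOL-Probability.Probability"
begin

definition second_moment_matrix :: "(real ^ 'd) measure \<Rightarrow> real ^ 'd ^ 'd" where
  "second_moment_matrix PX = (\<chi> i j. \<integral>x. x $ i * x $ j \<partial>PX)"

definition degenerate :: "(real ^ 'd) measure \<Rightarrow> bool" where
  "degenerate PX \<longleftrightarrow> (\<exists>\<theta>. norm \<theta> = 1 \<and> measure PX {x. \<theta> \<bullet> x = 0} > 0)"

text \<open>The kernel \<open>K\<close> is a regular conditional distribution of \<open>Z\<close> given \<open>X\<close> under \<open>P\<close>.\<close>

definition cond_distribution ::
  "'a measure \<Rightarrow> 'b measure \<Rightarrow> 'c measure \<Rightarrow> ('a \<Rightarrow> 'b) \<Rightarrow> ('a \<Rightarrow> 'c) \<Rightarrow> ('b \<Rightarrow> 'c measure) \<Rightarrow> bool" where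
  "cond_distribution P MX MZ X Z K \<longleftrightarrow>
     X \<in> P \<rightarrow>\<^sub>M MX \<and> Z \<in> P \<rightarrow>\<^sub>M MZ \<and> K \<in> MX \<rightarrow>\<^sub>M prob_algebra MZ \<and>
     (\<forall>A\<in>sets MX. \<forall>B\<in>sets MZ.
        emeasure P {\<omega> \<in> space P. X \<omega> \<in> A \<and> Z \<omega> \<in> B} = (\<integral>\<^sup>+x\<in>A. emeasure (K x) B \<partial>distr P MX X))"

text \<open>The parameter \<open>v\<close> is the noise variance, whereas \<^const>\<open>normal_density\<close> takes the
  standard deviation.\<close>

definition P_Gauss :: "(real ^ 'd) measure \<Rightarrow> real \<Rightarrow> ((real ^ 'd) \<times> real) measure set" where
  "P_Gauss PX v =
     {P. prob_space P \<and> sets P = sets borel \<and> distr P borel fst = PX \<and>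
         (\<exists>\<beta>. cond_distribution P borel borel fst (\<lambda>(x, y). y - \<beta> \<bullet> x)
                (\<lambda>_. density lborel (\<lambda>t. ennreal (normal_density 0 (sqrt v) t))))}"

definition risk :: "((real ^ 'd) \<times> real) measure \<Rightarrow> real ^ 'd \<Rightarrow> real" where
  "risk P \<beta> = (\<integral>(x, y). (y - \<beta> \<bullet> x)\<^sup>2 \<partial>P)"

text \<open>For \<open>P\<close> in the Gaussian class with finite, invertible second moment matrix, the
  minimizer of the risk is unique and equals the regression parameter of \<open>P\<close>.\<close>

definition risk_minimizer :: "((real ^ 'd) \<times> real) measure \<Rightarrow> real ^ 'd" where
  "risk_minimizer P = (ARG_MIN (risk P) \<beta>. True)"

definition excess_risk :: "((real ^ 'd) \<times> real) measure \<Rightarrow> real ^ 'd \<Rightarrow> real" where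
  "excess_risk P \<beta> = risk P \<beta> - risk P (risk_minimizer P)"

definition estimators :: "nat \<Rightarrow> ((nat \<Rightarrow> (real ^ 'd) \<times> real) \<Rightarrow> real ^ 'd) set" where
  "estimators n = (\<Pi>\<^sub>M i\<in>{..<n}. borel) \<rightarrow>\<^sub>M borel"

text \<open>The excess risk is nonnegative on the Gaussian class, so the \<^const>\<open>ennreal\<close>
  truncation is harmless and the expectation is well defined, possibly infinite.\<close>

definition expected_excess_risk ::
  "nat \<Rightarrow> ((real ^ 'd) \<times> real) measure \<Rightarrow> ((nat \<Rightarrow> (real ^ 'd) \<times> real) \<Rightarrow> real ^ 'd) \<Rightarrow> ennreal" where
  "expected_excess_risk n P b = (\<integral>\<^sup>+D. ennreal (excess_risk P (b D)) \<partial>(\<Pi>\<^sub>M i\<in>{..<n}. P))"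

definition minimax_excess_risk :: "nat \<Rightarrow> ((real ^ 'd) \<times> real) measure set \<Rightarrow> ennreal" where
  "minimax_excess_risk n \<P> = (INF b\<in>estimators n. SUP P\<in>\<P>. expected_excess_risk n P b)"

end

theory Submission
  imports Defs
begin

text \<open>
  Under either hypothesis there is, with positive probability, a unit vector \<open>\<theta>\<close> orthogonal to all
  the covariates in the sample: by a dimension count if there are fewer than \<open>d\<close> of them, and because
  independent covariates may all fall into one hyperplane if the design is degenerate.
  On that event the responses \<open>\<langle>\<beta>, X\<^sub>i\<rangle> + \<epsilon>\<^sub>i\<close> do not change when \<open>\<beta>\<close> is replaced by
  \<open>\<beta> + t \<theta>\<close>, so no estimator can tell the two parameters apart, although they are at distance \<open>t\<close>.

  The direction \<open>\<theta>\<close> depends on the sample. To avoid having to choose it measurably, all laws are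
  realised on one probability space, that of the covariates and the noise, which does not involve
  \<open>\<beta>\<close> (\<open>sample_law\<close>), and the risk is averaged over \<open>\<beta>\<close> in the ball of radius \<open>2 t\<close> with
  respect to Lebesgue measure. By Fubini the average over \<open>\<beta>\<close> may be taken first, with
  the covariates and the noise held fixed. There \<open>translation_invariant_error_bound\<close> applies, with
  whatever \<open>\<theta>\<close> exists at that point, and bounds the average squared error from below by a
  dimensional constant times \<open>t\<^sup>2\<close>. As the event has a probability that does not depend on \<open>t\<close>,
  letting \<open>t\<close> grow makes the supremum of the risks infinite (\<open>sup_risk_ge\<close>,
  \<open>minimax_excess_risk_infinite\<close>).

  The passage from excess risk to squared error uses invertibility of the second moment matrix: the
  excess risk is a positive definite quadratic form in the error, and therefore dominates a multiple of
  its squared norm (\<open>excess_risk_linear_model\<close>, \<open>prediction_energy_coercive\<close>).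
\<close>

section \<open>Averaging over translates\<close>

lemma nn_integral_lborel_translate:
  fixes c :: "'a::euclidean_space"
  assumes [measurable]: "f \<in> borel_measurable borel"
  shows "(\<integral>\<^sup>+x. f (x + c) \<partial>lborel) = (\<integral>\<^sup>+x. f x \<partial>lborel)"
proof -
  have "(\<integral>\<^sup>+x. f x \<partial>lborel) = (\<integral>\<^sup>+x. f x \<partial>distr lborel borel ((+) c))"
    by (simp add: lborel_distr_plus)
  also have "\<dots> = (\<integral>\<^sup>+x. f (x + c) \<partial>lborel)"
    by (subst nn_integral_distr) (auto simp: add.commute)
  finally show ?thesis by simp
qed

text \<open>
  The points \<open>\<beta>\<close> and \<open>\<beta> + u\<close> are at distance \<open>t\<close>, so the squared distances from them to the common
  value \<open>f \<beta> = f (\<beta> + u)\<close> add up to at least \<open>t\<^sup>2 / 2\<close>. Integrating this over the ball of radius \<open>t\<close> gives the bound, because both that ball and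
  its translate by \<open>u\<close> lie in the ball of radius \<open>2 t\<close>; the factor 2 on the right counts these two
  contributions.
\<close>

lemma translation_invariant_error_bound:
  fixes f :: "'a::euclidean_space \<Rightarrow> 'a"
  assumes f[measurable]: "f \<in> borel_measurable borel"
    and invariant: "\<And>\<beta>. f (\<beta> + u) = f \<beta>"
    and u: "norm u = t"
  shows "ennreal (t\<^sup>2 / 2) * emeasure lborel (ball 0 t :: 'a set)
    \<le> 2 * (\<integral>\<^sup>+\<beta>\<in>ball 0 (2 * t). ennreal ((norm (f \<beta> - \<beta>))\<^sup>2) \<partial>lborel)"
proof -
  define e where "e \<beta> = ennreal ((norm (f \<beta> - \<beta>))\<^sup>2)" for \<beta>
  have [measurable]: "e \<in> borel_measurable borel"
    unfolding e_def by measurable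
  have [measurable]: "ball (0::'a) r \<in> sets borel" for r by simp
  let ?I = "\<integral>\<^sup>+\<beta>\<in>ball 0 (2 * t). e \<beta> \<partial>lborel"
  have t: "t \<ge> 0" using u by auto
  have pointwise: "ennreal (t\<^sup>2 / 2) \<le> e \<beta> + e (\<beta> + u)" for \<beta>
  proof -
    let ?a = "f \<beta> - \<beta>"
    have "?a - (?a - u) = u" by simp
    hence "t \<le> norm ?a + norm (?a - u)"
      using u by (metis norm_triangle_ineq4)
    hence "t\<^sup>2 \<le> (norm ?a + norm (?a - u))\<^sup>2"
      using t by (rule power_mono)
    also have "\<dots> \<le> 2 * ((norm ?a)\<^sup>2 + (norm (?a - u))\<^sup>2)"
      using sum_squares_bound[of "norm ?a" "norm (?a - u)"] by (simp add: power2_sum)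
    finally have "t\<^sup>2 / 2 \<le> (norm ?a)\<^sup>2 + (norm (?a - u))\<^sup>2" by simp
    moreover have eq: "f (\<beta> + u) - (\<beta> + u) = ?a - u" by (simp add: invariant)
    ultimately show ?thesis
      unfolding e_def eq by (simp flip: ennreal_plus)
  qed
  have "ennreal (t\<^sup>2 / 2) * emeasure lborel (ball 0 t :: 'a set)
      = (\<integral>\<^sup>+\<beta>. ennreal (t\<^sup>2 / 2) * indicator (ball 0 t) \<beta> \<partial>(lborel :: 'a measure))"
    by (simp add: nn_integral_cmult_indicator)
  also have "\<dots> \<le> (\<integral>\<^sup>+\<beta>. e \<beta> * indicator (ball 0 t) \<beta> + e (\<beta> + u) * indicator (ball 0 t) \<beta> \<partial>lborel)"
    using pointwise by (intro nn_integral_mono) (auto split: split_indicator)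
  also have "\<dots> = (\<integral>\<^sup>+\<beta>. e \<beta> * indicator (ball 0 t) \<beta> \<partial>lborel)
      + (\<integral>\<^sup>+\<beta>. e (\<beta> + u) * indicator (ball 0 t) \<beta> \<partial>lborel)"
    by (rule nn_integral_add; measurable)
  also have "\<dots> \<le> ?I + ?I"
  proof (rule add_mono)
    show "(\<integral>\<^sup>+\<beta>. e \<beta> * indicator (ball 0 t) \<beta> \<partial>lborel) \<le> ?I"
      using t by (intro nn_integral_mono) (auto split: split_indicator)
    have "(\<integral>\<^sup>+\<beta>. e (\<beta> + u) * indicator (ball 0 t) \<beta> \<partial>lborel)
        \<le> (\<integral>\<^sup>+\<beta>. e (\<beta> + u) * indicator (ball 0 (2 * t)) (\<beta> + u) \<partial>lborel)"
    proof (intro nn_integral_mono)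
      fix \<beta> :: 'a
      have "norm (\<beta> + u) < 2 * t" if "norm \<beta> < t"
        using norm_triangle_ineq[of \<beta> u] that u by simp
      thus "e (\<beta> + u) * indicator (ball 0 t) \<beta> \<le> e (\<beta> + u) * indicator (ball 0 (2 * t)) (\<beta> + u)"
        by (auto split: split_indicator)
    qed
    also have "\<dots> = ?I"
      by (rule nn_integral_lborel_translate) measurable
    finally show "(\<integral>\<^sup>+\<beta>. e (\<beta> + u) * indicator (ball 0 t) \<beta> \<partial>lborel) \<le> ?I" .
  qed
  finally show ?thesis
    by (simp only: e_def mult_2)
qed

section \<open>The Gaussian linear model\<close>

definition gaussian_noise :: "real \<Rightarrow> real measure" where
  "gaussian_noise v = density lborel (\<lambda>t. ennreal (normal_density 0 (sqrt v) t))"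

definition linear_response :: "'a \<Rightarrow> 'a \<times> real \<Rightarrow> 'a::real_inner \<times> real" where
  "linear_response \<beta> z = (fst z, \<beta> \<bullet> fst z + snd z)"

definition linear_model :: "(real ^ 'd) measure \<Rightarrow> real \<Rightarrow> real ^ 'd \<Rightarrow> ((real ^ 'd) \<times> real) measure" where
  "linear_model PX v \<beta> = distr (PX \<Otimes>\<^sub>M gaussian_noise v) borel (linear_response \<beta>)"

lemma sets_gaussian_noise [simp, measurable_cong]: "sets (gaussian_noise v) = sets borel"
  by (simp add: gaussian_noise_def)

lemma space_gaussian_noise [simp]: "space (gaussian_noise v) = UNIV"
  by (simp add: gaussian_noise_def)

lemma prob_space_gaussian_noise: "v > 0 \<Longrightarrow> prob_space (gaussian_noise v)"
  unfolding gaussian_noise_def by (rule prob_space_normal_density) simp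

lemma gaussian_noise_moments:
  assumes "v > 0"
  shows "has_bochner_integral (gaussian_noise v) (\<lambda>e. e) 0"
    and "has_bochner_integral (gaussian_noise v) (\<lambda>e. e\<^sup>2) v"
proof -
  have s: "sqrt v > 0" using assms by simp
  show "has_bochner_integral (gaussian_noise v) (\<lambda>e. e) 0"
    unfolding gaussian_noise_def
    using normal_moment_odd[OF s, of 0 0] by (intro has_bochner_integral_density) auto
  have "has_bochner_integral lborel (\<lambda>x. normal_density 0 (sqrt v) x * x\<^sup>2) v"
    using normal_moment_even[OF s, of 0 1] assms by (simp add: fact_numeral)
  thus "has_bochner_integral (gaussian_noise v) (\<lambda>e. e\<^sup>2) v"
    unfolding gaussian_noise_def by (intro has_bochner_integral_density) auto
qed

locale random_design =
  fixes PX :: "(real ^ 'd) measure" and v :: real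
  assumes prob_PX: "prob_space PX" and sets_PX [measurable_cong]: "sets PX = sets borel"
    and square_integrable: "integrable PX (\<lambda>x. (norm x)\<^sup>2)"
    and v_pos: "v > 0"
begin

abbreviation noisy_design :: "((real ^ 'd) \<times> real) measure" where
  "noisy_design \<equiv> PX \<Otimes>\<^sub>M gaussian_noise v"

lemma space_PX: "space PX = UNIV"
  using sets_eq_imp_space_eq[OF sets_PX] by simp

lemma space_noisy_design: "space noisy_design = UNIV"
  by (simp add: space_pair_measure space_PX)

lemma measurable_linear_response [measurable]: "linear_response \<beta> \<in> noisy_design \<rightarrow>\<^sub>M borel"
  unfolding linear_response_def borel_prod[symmetric] by measurable

sublocale X: prob_space PX by (rule prob_PX)
sublocale noise: prob_space "gaussian_noise v" by (rule prob_space_gaussian_noise[OF v_pos])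
sublocale XN: pair_prob_space PX "gaussian_noise v" ..

text \<open>
  Subtracting \<open>\<langle>\<beta>, x\<rangle>\<close> from the response recovers the noise coordinate, which is independent of
  the covariate; hence the conditional law of the residual is the constant Gaussian kernel.
\<close>

lemma linear_model_in_P_Gauss: "linear_model PX v \<beta> \<in> P_Gauss PX v"
proof -
  have prob: "prob_space (linear_model PX v \<beta>)"
    unfolding linear_model_def by (rule XN.prob_space_distr) measurable
  have fst_borel: "(fst :: (real ^ 'd) \<times> real \<Rightarrow> _) \<in> borel \<rightarrow>\<^sub>M borel"
    unfolding borel_prod[symmetric] by measurable
  have fst_law: "distr (linear_model PX v \<beta>) borel fst = PX"
  proof -
    have "distr (linear_model PX v \<beta>) borel fst = distr noisy_design borel fst"
      unfolding linear_model_def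
      by (subst distr_distr[OF fst_borel measurable_linear_response])
        (simp add: comp_def linear_response_def)
    also have "\<dots> = distr noisy_design PX fst"
      by (rule distr_cong) (auto simp: sets_PX)
    finally show ?thesis by (simp add: noise.distr_pair_fst)
  qed
  have fst_meas: "fst \<in> linear_model PX v \<beta> \<rightarrow>\<^sub>M borel"
    unfolding linear_model_def borel_prod[symmetric] by measurable
  have residual_meas: "(\<lambda>(x, y). y - \<beta> \<bullet> x) \<in> linear_model PX v \<beta> \<rightarrow>\<^sub>M borel"
    unfolding linear_model_def borel_prod[symmetric] by measurable
  have rectangle: "emeasure (linear_model PX v \<beta>)
        {\<omega> \<in> space (linear_model PX v \<beta>). fst \<omega> \<in> A \<and> (case \<omega> of (x, y) \<Rightarrow> y - \<beta> \<bullet> x) \<in> B}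
      = (\<integral>\<^sup>+x\<in>A. emeasure (gaussian_noise v) B \<partial>PX)"
    if A: "A \<in> sets borel" and B: "B \<in> sets borel" for A B
  proof -
    let ?S = "{\<omega> \<in> space (linear_model PX v \<beta>). fst \<omega> \<in> A \<and> (case \<omega> of (x, y) \<Rightarrow> y - \<beta> \<bullet> x) \<in> B}"
    have "?S \<in> sets (linear_model PX v \<beta>)"
      using fst_meas residual_meas A B by measurable
    hence S: "?S \<in> sets borel" by (simp add: linear_model_def)
    have "emeasure (linear_model PX v \<beta>) ?S
        = emeasure noisy_design (linear_response \<beta> -` ?S \<inter> space noisy_design)"
      using S unfolding linear_model_def by (subst emeasure_distr) auto
    \<comment> \<open>In the coordinates (covariate, noise) the event is a rectangle, so its probability factors.\<close>
    also have "linear_response \<beta> -` ?S \<inter> space noisy_design = A \<times> B"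
      by (auto simp: linear_response_def linear_model_def space_noisy_design)
    also have "emeasure noisy_design (A \<times> B) = emeasure PX A * emeasure (gaussian_noise v) B"
      using A B by (intro noise.emeasure_pair_measure_Times) (auto simp: sets_PX)
    also have "\<dots> = (\<integral>\<^sup>+x\<in>A. emeasure (gaussian_noise v) B \<partial>PX)"
      using A by (simp add: nn_integral_cmult_indicator sets_PX mult.commute[of "emeasure PX A"])
    finally show ?thesis .
  qed
  have kernel: "gaussian_noise v \<in> space (prob_algebra borel)"
    by (simp add: space_prob_algebra noise.prob_space_axioms)
  have "cond_distribution (linear_model PX v \<beta>) borel borel fst (\<lambda>(x, y). y - \<beta> \<bullet> x)
      (\<lambda>_. gaussian_noise v)"
    unfolding cond_distribution_def fst_law
    using fst_meas residual_meas rectangle kernel by auto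
  thus ?thesis
    unfolding P_Gauss_def
    using prob fst_law by (auto simp: gaussian_noise_def linear_model_def)
qed

text \<open>
  This is \<open>\<parallel>\<Sigma>\<^sup>1\<^sup>/\<^sup>2 \<delta>\<parallel>\<^sup>2\<close>, the quadratic form of the second moment matrix; writing it as an integral
  makes sense of it without a matrix square root.
\<close>

definition prediction_energy :: "real ^ 'd \<Rightarrow> real" where
  "prediction_energy \<delta> = (\<integral>x. (\<delta> \<bullet> x)\<^sup>2 \<partial>PX)"

lemma integrable_inner_mult: "integrable PX (\<lambda>x. (a \<bullet> x) * (b \<bullet> x))"
proof (rule Bochner_Integration.integrable_bound)
  show "integrable PX (\<lambda>x. norm a * norm b * (norm x)\<^sup>2)"
    using square_integrable by simp
  show "AE x in PX. norm ((a \<bullet> x) * (b \<bullet> x)) \<le> norm (norm a * norm b * (norm x)\<^sup>2)"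
  proof (rule AE_I2)
    fix x
    have "\<bar>a \<bullet> x\<bar> * \<bar>b \<bullet> x\<bar> \<le> (norm a * norm x) * (norm b * norm x)"
      by (intro mult_mono Cauchy_Schwarz_ineq2) auto
    thus "norm ((a \<bullet> x) * (b \<bullet> x)) \<le> norm (norm a * norm b * (norm x)\<^sup>2)"
      by (simp add: abs_mult power2_eq_square mult_ac)
  qed
qed measurable

lemma integrable_inner_square: "integrable PX (\<lambda>x. (\<delta> \<bullet> x)\<^sup>2)"
  using integrable_inner_mult[of \<delta> \<delta>] by (simp add: power2_eq_square)

text \<open>
  The prediction error is \<open>\<langle>\<beta> - \<gamma>, X\<rangle> + \<epsilon>\<close>; integrating out the centred noise first removes the
  cross term and turns \<open>\<epsilon>\<^sup>2\<close> into \<open>v\<close>.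
\<close>

lemma risk_linear_model:
  "risk (linear_model PX v \<beta>) \<gamma> = prediction_energy (\<gamma> - \<beta>) + v"
proof -
  let ?g = "\<lambda>z. ((\<beta> - \<gamma>) \<bullet> fst z + snd z)\<^sup>2"
  have noise1: "integrable (gaussian_noise v) (\<lambda>e. e)" "(\<integral>e. e \<partial>gaussian_noise v) = 0"
    and noise2: "integrable (gaussian_noise v) (\<lambda>e. e\<^sup>2)" "(\<integral>e. e\<^sup>2 \<partial>gaussian_noise v) = v"
    using gaussian_noise_moments[OF v_pos] by (auto simp: has_bochner_integral_iff)
  have inner: "(\<integral>e. (a + e)\<^sup>2 \<partial>gaussian_noise v) = a\<^sup>2 + v" for a
    using noise1 noise2 by (simp add: power2_sum noise.prob_space[simplified])
  have int: "integrable noisy_design ?g"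
  proof (rule XN.Fubini_integrable)
    show "integrable PX (\<lambda>x. \<integral>e. norm (?g (x, e)) \<partial>gaussian_noise v)"
      using integrable_inner_square by (simp add: inner)
    show "AE x in PX. integrable (gaussian_noise v) (\<lambda>e. ?g (x, e))"
      using noise1 noise2 by (simp add: power2_sum)
  qed measurable
  have loss: "(\<lambda>(x, y). (y - \<gamma> \<bullet> x)\<^sup>2) \<in> borel_measurable borel"
    unfolding borel_prod[symmetric] by measurable
  have "risk (linear_model PX v \<beta>) \<gamma> = (\<integral>z. ?g z \<partial>noisy_design)"
    unfolding risk_def linear_model_def
    by (subst integral_distr[OF measurable_linear_response loss])
      (simp add: linear_response_def inner_diff_left algebra_simps)
  also have "\<dots> = (\<integral>x. ((\<beta> - \<gamma>) \<bullet> x)\<^sup>2 + v \<partial>PX)"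
    using XN.integral_fst'[OF int] by (simp add: inner)
  also have "\<dots> = (\<integral>x. ((\<beta> - \<gamma>) \<bullet> x)\<^sup>2 \<partial>PX) + v"
    using integrable_inner_square by (simp add: X.prob_space[simplified])
  also have "(\<lambda>x. ((\<beta> - \<gamma>) \<bullet> x)\<^sup>2) = (\<lambda>x. ((\<gamma> - \<beta>) \<bullet> x)\<^sup>2)"
    by (simp add: inner_diff_left power2_commute)
  finally show ?thesis by (simp add: prediction_energy_def)
qed

lemma excess_risk_linear_model:
  "excess_risk (linear_model PX v \<beta>) \<gamma> = prediction_energy (\<gamma> - \<beta>)"
proof -
  have "risk (linear_model PX v \<beta>) (risk_minimizer (linear_model PX v \<beta>))
      = risk (linear_model PX v \<beta>) \<beta>"
    unfolding risk_minimizer_def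
    by (rule arg_min_equality) (auto simp: risk_linear_model prediction_energy_def)
  thus ?thesis
    by (simp add: excess_risk_def risk_linear_model prediction_energy_def)
qed

lemma second_moment_matrix_mult_vec:
  "(second_moment_matrix PX *v \<delta>) $ i = (\<integral>x. x $ i * (\<delta> \<bullet> x) \<partial>PX)"
proof -
  have *: "integrable PX (\<lambda>x. x $ i * x $ j)" for j
    using integrable_inner_mult[of "axis i 1" "axis j 1"] by (simp add: inner_axis')
  have "(\<integral>x. x $ i * (\<delta> \<bullet> x) \<partial>PX) = (\<integral>x. (\<Sum>j\<in>UNIV. \<delta> $ j * (x $ i * x $ j)) \<partial>PX)"
    by (simp add: inner_vec_def sum_distrib_left mult_ac)
  also have "\<dots> = (\<Sum>j\<in>UNIV. \<delta> $ j * (\<integral>x. x $ i * x $ j \<partial>PX))"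
    using * by simp
  finally show ?thesis
    by (simp add: second_moment_matrix_def matrix_vector_mult_def mult.commute)
qed

lemma prediction_energy_eq_quadratic_form:
  "prediction_energy \<delta> = \<delta> \<bullet> (second_moment_matrix PX *v \<delta>)"
proof -
  have *: "integrable PX (\<lambda>x. x $ i * (\<delta> \<bullet> x))" for i
    using integrable_inner_mult[of "axis i 1" \<delta>] by (simp add: inner_axis')
  have "prediction_energy \<delta> = (\<integral>x. (\<Sum>i\<in>UNIV. \<delta> $ i * (x $ i * (\<delta> \<bullet> x))) \<partial>PX)"
    unfolding prediction_energy_def
    by (rule Bochner_Integration.integral_cong)
      (auto simp: power2_eq_square inner_vec_def sum_distrib_right mult_ac)
  also have "\<dots> = (\<Sum>i\<in>UNIV. \<delta> $ i * (\<integral>x. x $ i * (\<delta> \<bullet> x) \<partial>PX))"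
    using * by simp
  finally show ?thesis
    by (simp add: inner_vec_def second_moment_matrix_mult_vec)
qed

lemma continuous_on_prediction_energy: "continuous_on A prediction_energy"
  unfolding prediction_energy_eq_quadratic_form
  by (intro continuous_intros linear_continuous_on_compose[OF continuous_on_id]) auto

lemma borel_measurable_prediction_energy [measurable]: "prediction_energy \<in> borel_measurable borel"
  by (rule borel_measurable_continuous_onI) (rule continuous_on_prediction_energy)

lemma prediction_energy_scaleR: "prediction_energy (r *\<^sub>R \<delta>) = r\<^sup>2 * prediction_energy \<delta>"
  by (simp add: prediction_energy_def power_mult_distrib)

text \<open>
  If the energy of \<open>\<delta>\<close> vanishes, then \<open>\<langle>\<delta>, X\<rangle> = 0\<close> almost surely, which puts \<open>\<delta>\<close> into the kernel
  of the second moment matrix.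
\<close>

lemma prediction_energy_pos:
  assumes inv: "invertible (second_moment_matrix PX)" and "\<delta> \<noteq> 0"
  shows "prediction_energy \<delta> > 0"
proof (rule ccontr)
  assume "\<not> prediction_energy \<delta> > 0"
  moreover have "prediction_energy \<delta> \<ge> 0" by (simp add: prediction_energy_def)
  ultimately have "prediction_energy \<delta> = 0" by linarith
  hence "(\<integral>x. (\<delta> \<bullet> x)\<^sup>2 \<partial>PX) = 0" by (simp only: prediction_energy_def)
  hence "AE x in PX. (\<delta> \<bullet> x)\<^sup>2 = 0"
    using integral_nonneg_eq_0_iff_AE[OF integrable_inner_square] by simp
  hence ae: "AE x in PX. \<delta> \<bullet> x = 0" by simp
  have "second_moment_matrix PX *v \<delta> = 0"
  proof (subst vec_eq_iff, intro allI)
    fix i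
    have "(\<integral>x. x $ i * (\<delta> \<bullet> x) \<partial>PX) = 0"
      using ae by (intro integral_eq_zero_AE) auto
    thus "(second_moment_matrix PX *v \<delta>) $ i = 0 $ i"
      by (simp add: second_moment_matrix_mult_vec)
  qed
  moreover obtain B where "B ** second_moment_matrix PX = mat 1"
    using inv by (auto simp: invertible_def)
  ultimately have "\<delta> = 0"
    by (metis matrix_left_invertible_ker)
  with \<open>\<delta> \<noteq> 0\<close> show False by simp
qed

text \<open>The constant is the minimum of the form on the unit sphere, attained by compactness.\<close>

lemma prediction_energy_coercive:
  assumes inv: "invertible (second_moment_matrix PX)"
  obtains c where "c > 0" "\<And>\<delta>. c * (norm \<delta>)\<^sup>2 \<le> prediction_energy \<delta>"
proof -
  have nonempty: "sphere (0::real^'d) 1 \<noteq> {}" by simp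
  obtain \<delta>0 :: "real ^ 'd" where \<delta>0: "norm \<delta>0 = 1"
    and min: "\<And>\<delta>. norm \<delta> = 1 \<Longrightarrow> prediction_energy \<delta>0 \<le> prediction_energy \<delta>"
    using continuous_attains_inf[OF compact_sphere nonempty continuous_on_prediction_energy] by auto
  show ?thesis
  proof
    show "prediction_energy \<delta>0 > 0"
      using \<delta>0 by (intro prediction_energy_pos[OF inv]) auto
    fix \<delta> :: "real ^ 'd"
    show "prediction_energy \<delta>0 * (norm \<delta>)\<^sup>2 \<le> prediction_energy \<delta>"
    proof (cases "\<delta> = 0")
      case False
      hence "prediction_energy \<delta>0 \<le> prediction_energy ((1 / norm \<delta>) *\<^sub>R \<delta>)"
        by (intro min) simp
      also have "\<dots> = prediction_energy \<delta> / (norm \<delta>)\<^sup>2"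
        by (simp add: prediction_energy_scaleR power_divide)
      finally show ?thesis using False by (simp add: field_simps)
    qed (simp add: prediction_energy_def)
  qed
qed

section \<open>Undetected directions force infinite risk\<close>

abbreviation draws :: "nat \<Rightarrow> (nat \<Rightarrow> (real ^ 'd) \<times> real) measure" where
  "draws n \<equiv> (\<Pi>\<^sub>M i\<in>{..<n}. noisy_design)"

lemma prob_space_draws: "prob_space (draws n)"
  by (rule prob_space_PiM) (rule XN.prob_space_axioms)

text \<open>
  This couples the samples for all parameters \<open>\<beta>\<close> on the single space \<open>draws n\<close>, so that an average
  over \<open>\<beta>\<close> can be exchanged with the expectation over the sample.
\<close>

lemma sample_law:
  "(\<Pi>\<^sub>M i\<in>{..<n}. linear_model PX v \<beta>)
    = distr (draws n) (\<Pi>\<^sub>M i\<in>{..<n}. borel) (compose {..<n} (linear_response \<beta>))"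
proof -
  have prob: "prob_space (linear_model PX v \<beta>)"
    unfolding linear_model_def by (rule XN.prob_space_distr) measurable
  have "linear_model PX v \<beta> = distr noisy_design (linear_model PX v \<beta>) (linear_response \<beta>)"
    unfolding linear_model_def by (intro distr_cong) simp_all
  hence "(\<Pi>\<^sub>M i\<in>{..<n}. linear_model PX v \<beta>)
      = (\<Pi>\<^sub>M i\<in>{..<n}. distr noisy_design (linear_model PX v \<beta>) (linear_response \<beta>))"
    by simp
  also have "\<dots> = distr (draws n) (\<Pi>\<^sub>M i\<in>{..<n}. linear_model PX v \<beta>) (compose {..<n} (linear_response \<beta>))"
  proof (rule distr_PiM_finite_prob_space'[symmetric])
    show "linear_response \<beta> \<in> noisy_design \<rightarrow>\<^sub>M linear_model PX v \<beta>"
      using measurable_linear_response by (simp add: linear_model_def)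
  qed (simp_all add: XN.prob_space_axioms prob)
  also have "\<dots> = distr (draws n) (\<Pi>\<^sub>M i\<in>{..<n}. borel) (compose {..<n} (linear_response \<beta>))"
    by (intro distr_cong sets_PiM_cong) (simp_all add: linear_model_def)
  finally show ?thesis .
qed

text \<open>
  The event lives on the space of covariates and noise, so that one and the same event serves for all
  parameters \<open>\<beta>\<close>.
\<close>

definition undetected_event :: "nat \<Rightarrow> (nat \<Rightarrow> (real ^ 'd) \<times> real) set \<Rightarrow> bool" where
  "undetected_event n G \<longleftrightarrow> G \<in> sets (draws n) \<and> emeasure (draws n) G > 0 \<and>
     (\<forall>\<omega>\<in>G. \<exists>\<theta>. norm \<theta> = 1 \<and> (\<forall>i<n. \<theta> \<bullet> fst (\<omega> i) = 0))"

lemma measurable_sample [measurable]: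
  "(\<lambda>(\<beta>, \<omega>). compose {..<n} (linear_response \<beta>) \<omega>)
     \<in> borel \<Otimes>\<^sub>M draws n \<rightarrow>\<^sub>M (\<Pi>\<^sub>M i\<in>{..<n}. borel)"
  unfolding compose_def linear_response_def borel_prod[symmetric] split_beta by measurable

text \<open>
  The supremum of the risks is at least their average over \<open>\<beta>\<close> in the ball of radius \<open>2 t\<close>. The
  translation bound, applied for each fixed \<open>\<omega>\<close> in \<open>G\<close>, compares that average with the volume of the
  ball of radius \<open>t\<close>; the ratio of the two volumes produces the factor \<open>2 ^ CARD('d)\<close>.
\<close>

lemma sup_risk_ge:
  assumes G: "undetected_event n G" and b: "b \<in> estimators n"
    and c: "c > 0" "\<And>\<delta>. c * (norm \<delta>)\<^sup>2 \<le> prediction_energy \<delta>" and t: "t > 0"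
  shows "ennreal (c * t\<^sup>2 / 2) * emeasure (draws n) G
    \<le> 2 * 2 ^ CARD('d) * (SUP P\<in>P_Gauss PX v. expected_excess_risk n P b)"
proof -
  let ?S = "SUP P\<in>P_Gauss PX v. expected_excess_risk n P b"
  let ?V = "emeasure lborel (ball 0 t :: (real ^ 'd) set)"
  let ?sample = "\<lambda>\<beta>. compose {..<n} (linear_response \<beta>)"
  define L where "L \<beta> \<omega> = ennreal ((norm (b (?sample \<beta> \<omega>) - \<beta>))\<^sup>2)" for \<beta> \<omega>
  interpret D: prob_space "draws n" by (rule prob_space_draws)
  interpret LD: pair_sigma_finite "lborel :: (real ^ 'd) measure" "draws n" ..
  have [measurable]: "ball (0 :: real ^ 'd) r \<in> sets borel" for r by simp
  have [measurable]: "G \<in> sets (draws n)" using G by (simp add: undetected_event_def)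
  have b_meas [measurable]: "b \<in> (\<Pi>\<^sub>M i\<in>{..<n}. borel) \<rightarrow>\<^sub>M borel"
    using b by (simp add: estimators_def)
  have "(\<lambda>p. b (case p of (\<beta>, \<omega>) \<Rightarrow> ?sample \<beta> \<omega>)) \<in> borel_measurable (borel \<Otimes>\<^sub>M draws n)"
    by (rule measurable_compose[OF measurable_sample b_meas])
  hence bs [measurable]: "(\<lambda>(\<beta>, \<omega>). b (?sample \<beta> \<omega>)) \<in> borel_measurable (borel \<Otimes>\<^sub>M draws n)"
    by (simp add: split_beta)
  have L_meas [measurable]: "(\<lambda>(\<beta>, \<omega>). L \<beta> \<omega>) \<in> borel_measurable (borel \<Otimes>\<^sub>M draws n)"
    unfolding L_def by measurable
  have risk_le: "ennreal c * (\<integral>\<^sup>+\<omega>. L \<beta> \<omega> \<partial>draws n) \<le> ?S" for \<beta>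
  proof -
    have [measurable]: "?sample \<beta> \<in> draws n \<rightarrow>\<^sub>M (\<Pi>\<^sub>M i\<in>{..<n}. borel)"
      using measurable_Pair2[OF measurable_sample, of \<beta> n] by simp
    have "ennreal c * (\<integral>\<^sup>+\<omega>. L \<beta> \<omega> \<partial>draws n) = (\<integral>\<^sup>+\<omega>. ennreal c * L \<beta> \<omega> \<partial>draws n)"
      by (rule nn_integral_cmult[symmetric]) (simp add: L_def)
    also have "\<dots> \<le> (\<integral>\<^sup>+\<omega>. ennreal (excess_risk (linear_model PX v \<beta>) (b (?sample \<beta> \<omega>))) \<partial>draws n)"
      using c by (intro nn_integral_mono)
        (auto simp: L_def excess_risk_linear_model ennreal_mult'[symmetric] intro!: ennreal_leI)
    also have "\<dots> = expected_excess_risk n (linear_model PX v \<beta>) b"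
      unfolding expected_excess_risk_def sample_law
      by (subst nn_integral_distr)
        (simp_all add: excess_risk_linear_model)
    also have "\<dots> \<le> ?S"
      by (rule SUP_upper) (rule linear_model_in_P_Gauss)
    finally show ?thesis .
  qed
  have error_ge: "ennreal (t\<^sup>2 / 2) * ?V * indicator G \<omega>
      \<le> 2 * (\<integral>\<^sup>+\<beta>\<in>ball 0 (2 * t). L \<beta> \<omega> \<partial>lborel)"
    if \<omega>: "\<omega> \<in> space (draws n)" for \<omega>
  proof (cases "\<omega> \<in> G")
    case True
    then obtain \<theta> where \<theta>: "norm \<theta> = 1" "\<And>i. i < n \<Longrightarrow> \<theta> \<bullet> fst (\<omega> i) = 0"
      using G by (auto simp: undetected_event_def)
    have "?sample (\<beta> + t *\<^sub>R \<theta>) \<omega> = ?sample \<beta> \<omega>" for \<beta>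
      by (auto simp: compose_def linear_response_def inner_add_left \<theta>)
    moreover have "(\<lambda>\<beta>. b (?sample \<beta> \<omega>)) \<in> borel_measurable borel"
      using measurable_Pair1[OF bs \<omega>] by simp
    ultimately show ?thesis
      using translation_invariant_error_bound[of "\<lambda>\<beta>. b (?sample \<beta> \<omega>)" "t *\<^sub>R \<theta>" t] \<theta> t True
      by (simp add: L_def)
  qed simp
  have "?V * (ennreal (c * t\<^sup>2 / 2) * emeasure (draws n) G)
      = ennreal c * (\<integral>\<^sup>+\<omega>. ennreal (t\<^sup>2 / 2) * ?V * indicator G \<omega> \<partial>draws n)"
  proof -
    have "ennreal (c * t\<^sup>2 / 2) = ennreal c * ennreal (t\<^sup>2 / 2)"
      using c by (simp flip: ennreal_mult)
    moreover have "(\<integral>\<^sup>+\<omega>. ennreal (t\<^sup>2 / 2) * ?V * indicator G \<omega> \<partial>draws n)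
        = ennreal (t\<^sup>2 / 2) * ?V * emeasure (draws n) G"
      by (rule nn_integral_cmult_indicator) measurable
    ultimately show ?thesis by (simp only: mult_ac)
  qed
  also have "\<dots> \<le> ennreal c * (\<integral>\<^sup>+\<omega>. 2 * (\<integral>\<^sup>+\<beta>\<in>ball 0 (2 * t). L \<beta> \<omega> \<partial>lborel) \<partial>draws n)"
    by (intro mult_left_mono nn_integral_mono error_ge) auto
  also have "\<dots> = 2 * ennreal c * (\<integral>\<^sup>+\<omega>. (\<integral>\<^sup>+\<beta>\<in>ball 0 (2 * t). L \<beta> \<omega> \<partial>lborel) \<partial>draws n)"
    by (subst nn_integral_cmult, measurable) (simp add: mult_ac)
  also have "(\<integral>\<^sup>+\<omega>. (\<integral>\<^sup>+\<beta>\<in>ball 0 (2 * t). L \<beta> \<omega> \<partial>lborel) \<partial>draws n)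
      = (\<integral>\<^sup>+\<beta>. (\<integral>\<^sup>+\<omega>. L \<beta> \<omega> * indicator (ball 0 (2 * t)) \<beta> \<partial>draws n) \<partial>lborel)"
    by (rule LD.Fubini') measurable
  also have "2 * ennreal c * \<dots>
      = 2 * (\<integral>\<^sup>+\<beta>\<in>ball 0 (2 * t). ennreal c * (\<integral>\<^sup>+\<omega>. L \<beta> \<omega> \<partial>draws n) \<partial>lborel)"
    by (simp add: nn_integral_multc nn_integral_cmult mult.assoc)
  also have "\<dots> \<le> 2 * (\<integral>\<^sup>+\<beta>\<in>ball (0 :: real ^ 'd) (2 * t). ?S \<partial>lborel)"
  proof (rule mult_left_mono)
    show "(\<integral>\<^sup>+\<beta>\<in>ball 0 (2 * t). ennreal c * (\<integral>\<^sup>+\<omega>. L \<beta> \<omega> \<partial>draws n) \<partial>lborel)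
        \<le> (\<integral>\<^sup>+\<beta>\<in>ball (0 :: real ^ 'd) (2 * t). ?S \<partial>lborel)"
      by (intro nn_integral_mono mult_right_mono risk_le) simp
  qed simp
  also have "\<dots> = 2 * (?S * emeasure lborel (ball 0 (2 * t) :: (real ^ 'd) set))"
    by (simp add: nn_integral_cmult_indicator)
  also have "emeasure lborel (ball 0 (2 * t) :: (real ^ 'd) set) = 2 ^ CARD('d) * ?V"
    using t by (simp add: emeasure_ball power_mult_distrib ennreal_mult mult_ac flip: ennreal_power)
  finally have "?V * (ennreal (c * t\<^sup>2 / 2) * emeasure (draws n) G) \<le> ?V * (2 * 2 ^ CARD('d) * ?S)"
    by (simp add: mult_ac)
  moreover have "?V \<noteq> 0" "?V \<noteq> \<infinity>"
    using t unit_ball_vol_pos[OF of_nat_0_le_iff, THEN less_imp_neq, symmetric] by (simp_all add: emeasure_ball)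
  ultimately show ?thesis
    by (simp add: ennreal_mult_le_mult_iff)
qed

lemma minimax_excess_risk_infinite:
  assumes inv: "invertible (second_moment_matrix PX)" and G: "undetected_event n G"
  shows "minimax_excess_risk n (P_Gauss PX v) = \<infinity>"
proof -
  obtain c where c: "c > 0" "\<And>\<delta>. c * (norm \<delta>)\<^sup>2 \<le> prediction_energy \<delta>"
    using prediction_energy_coercive[OF inv] by blast
  interpret D: prob_space "draws n" by (rule prob_space_draws)
  define p where "p = measure (draws n) G"
  have p: "p > 0" "emeasure (draws n) G = ennreal p"
    using G by (auto simp: p_def D.emeasure_eq_measure undetected_event_def)
  have "(SUP P\<in>P_Gauss PX v. expected_excess_risk n P b) = \<infinity>" if b: "b \<in> estimators n" for b
  proof (rule ccontr)
    assume "(SUP P\<in>P_Gauss PX v. expected_excess_risk n P b) \<noteq> \<infinity>"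
    then obtain s where s: "s \<ge> 0" "(SUP P\<in>P_Gauss PX v. expected_excess_risk n P b) = ennreal s"
      by (metis ennreal_cases infinity_ennreal_def)
    let ?K = "2 * 2 ^ CARD('d) * s"
    have bound: "c * t\<^sup>2 / 2 * p \<le> ?K" if "t > 0" for t
    proof -
      have "ennreal (c * t\<^sup>2 / 2 * p) = ennreal (c * t\<^sup>2 / 2) * ennreal p"
        using c p by (intro ennreal_mult) auto
      also have "\<dots> \<le> 2 * 2 ^ CARD('d) * ennreal s"
        using sup_risk_ge[OF G b c that] by (simp only: s p)
      also have "\<dots> = ennreal ?K"
        using s by (simp add: ennreal_mult flip: ennreal_power)
      finally have "ennreal (c * t\<^sup>2 / 2 * p) \<le> ennreal ?K" .
      thus ?thesis using s by (subst (asm) ennreal_le_iff) auto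
    qed
    \<comment> \<open>The value of \<open>t\<close> at which the left-hand side of \<open>bound\<close> equals \<open>?K + 1\<close>.\<close>
    define t where "t = sqrt (2 * (?K + 1) / (c * p))"
    have "2 * (?K + 1) / (c * p) > 0"
      using s c p by (intro divide_pos_pos mult_pos_pos add_nonneg_pos) auto
    hence t: "t > 0" "t\<^sup>2 = 2 * (?K + 1) / (c * p)"
      by (auto simp: t_def)
    have "c * t\<^sup>2 / 2 * p = ?K + 1"
      using c p unfolding t(2) by simp
    with bound[OF t(1)] show False by linarith
  qed
  thus ?thesis
    unfolding minimax_excess_risk_def by (simp add: INF_top_conv)
qed

text \<open>Fewer than \<open>d\<close> covariates span a proper subspace, which has a nonzero normal vector.\<close>

lemma undetected_event_few_samples:
  assumes "n < CARD('d)"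
  shows "undetected_event n (space (draws n))"
  unfolding undetected_event_def
proof (intro conjI ballI)
  interpret D: prob_space "draws n" by (rule prob_space_draws)
  show "emeasure (draws n) (space (draws n)) > 0" by (simp add: D.emeasure_space_1)
  fix \<omega> :: "nat \<Rightarrow> (real ^ 'd) \<times> real"
  let ?X = "(\<lambda>i. fst (\<omega> i)) ` {..<n}"
  have "dim ?X \<le> card ?X" by (rule dim_le_card') simp
  also have "\<dots> \<le> n" using card_image_le[of "{..<n}"] by simp
  finally have "dim ?X < DIM(real ^ 'd)" using assms by simp
  then obtain u where u: "u \<noteq> 0" "\<And>y. y \<in> span ?X \<Longrightarrow> orthogonal u y"
    using orthogonal_to_subspace_exists by blast
  show "\<exists>\<theta>. norm \<theta> = 1 \<and> (\<forall>i<n. \<theta> \<bullet> fst (\<omega> i) = 0)"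
  proof (intro exI conjI allI impI)
    show "norm ((1 / norm u) *\<^sub>R u) = 1" using u by simp
    show "((1 / norm u) *\<^sub>R u) \<bullet> fst (\<omega> i) = 0" if "i < n" for i
      using u(2)[of "fst (\<omega> i)"] that by (simp add: orthogonal_def span_base)
  qed
qed simp

text \<open>
  By independence, all covariates lie in a hyperplane of probability \<open>p\<close> with probability \<open>p ^ n\<close>,
  and its normal vector serves for every such sample.
\<close>

lemma undetected_event_degenerate:
  assumes "degenerate PX"
  obtains G where "undetected_event n G"
proof -
  obtain \<theta> where \<theta>: "norm \<theta> = 1" "measure PX {x. \<theta> \<bullet> x = 0} > 0"
    using assms by (auto simp: degenerate_def)
  let ?H = "{x. \<theta> \<bullet> x = 0}"
  let ?G = "\<Pi>\<^sub>E i\<in>{..<n}. ?H \<times> (UNIV :: real set)"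
  have "closed ?H" by (rule closed_hyperplane)
  hence H: "?H \<in> sets PX" by (simp add: sets_PX)
  hence HN: "?H \<times> UNIV \<in> sets noisy_design"
    by (intro pair_measureI) auto
  interpret product_prob_space "\<lambda>_::nat. noisy_design" ..
  have "emeasure noisy_design (?H \<times> UNIV) = emeasure PX ?H"
    using noise.emeasure_space_1 H by (subst noise.emeasure_pair_measure_Times) auto
  also have "\<dots> > 0" using \<theta> by (simp add: X.emeasure_eq_measure)
  finally have pos: "emeasure noisy_design (?H \<times> UNIV) > 0" .
  have "emeasure (draws n) ?G = (\<Prod>i<n. emeasure noisy_design (?H \<times> UNIV))"
    using HN by (intro emeasure_PiM) auto
  also have "\<dots> = emeasure noisy_design (?H \<times> UNIV) ^ n"
    by (simp only: prod_constant card_lessThan)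
  also have "\<dots> > 0"
    using pos by (metis power_eq_0_iff zero_less_iff_neq_zero)
  finally have "emeasure (draws n) ?G > 0" .
  moreover have "?G \<in> sets (draws n)" using HN by (intro sets_PiM_I_finite) auto
  moreover have "\<theta> \<bullet> fst (\<omega> i) = 0" if "\<omega> \<in> ?G" "i < n" for \<omega> i
    using PiE_mem[OF that(1), of i] that(2) by (auto simp: mem_Times_iff)
  ultimately show thesis
    using \<theta> by (intro that[of ?G]) (auto simp: undetected_event_def)
qed

end

theorem proposition1:
  fixes PX :: "(real ^ 'd) measure" and v :: real and n :: nat
  assumes "n \<ge> 1" and "v > 0"
    and "prob_space PX" and "sets PX = sets borel"
    and "integrable PX (\<lambda>x. (norm x)\<^sup>2)"
    and "invertible (second_moment_matrix PX)"
    and "n < CARD('d) \<or> degenerate PX"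
  shows "minimax_excess_risk n (P_Gauss PX v) = \<infinity>"
proof -
  interpret random_design PX v
    by (rule random_design.intro) (fact assms)+
  obtain G where "undetected_event n G"
    using assms(7)
  proof
    assume "n < CARD('d)"
    thus thesis by (rule that[OF undetected_event_few_samples])
  next
    assume "degenerate PX"
    thus thesis by (rule undetected_event_degenerate) (rule that)
  qed
  thus ?thesis by (rule minimax_excess_risk_infinite[OF assms(6)])
qed

end
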